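(* Let $k \ge 4$ and let $n$ be an integer with $n > \frac{k^2+k-2}{2}$. Then the size-Ramsey number of the $k$-uniform tight path on $n$ vertices satisfies $$\hat{R}^{(k)}\big(P^{(k)}_{n,k-1}\big) \ge \big\lceil \log_2(k+1)\big\rceil \cdot n - 2k^2.$$
   Context: A $k$-graph is a $k$-uniform hypergraph $G=(V,E)$ with $E\subseteq\binom{V}{k}$. A ($2$-edge) coloring of a $k$-graph $G$ is any function $c\colon E(G)\to\{\text{red},\text{blue}\}$. For $k$-graphs $G,H$ we write $G\rightarrow H$ if every coloring of $G$ contains a monochromatic copy of $H$ (a subhypergraph isomorphic to $H$ all of whose edges have the same color). The size-Ramsey number of a $k$-graph $H$ is $\hat{R}^{(k)}(H)=\min\{m\in\mathbb{N}: \text{there is a } k\text{-graph } G \text{ with } |E(G)|=m \text{ and } G\rightarrow H\}$. For $k\ge 2$ and $n\ge k$, the $k$-uniform tight path on $n$ vertices, $P^{(k)}_{n,k-1}$, is the $k$-graph on $n$ vertices for which there is an ordering $v_1,\dots,v_n$ of its vertices such that its edges are exactly the sets $\{v_j,v_{j+1},\dots,v_{j+k-1}\}$ for $1\le j\le n-k+1$. *)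

theory Defs
  imports Complex_Main "HOL-Library.Ramsey"
begin

record 'a hypergraph =
  verts :: "'a set"
  edges :: "'a set set"

(* Finiteness is essential: card is 0 on infinite sets, so without it an infinite edge set
   would count as having no edges in size_ramsey. *)
definition kgraph :: "nat \<Rightarrow> 'a hypergraph \<Rightarrow> bool" where
  "kgraph k G \<longleftrightarrow> finite (verts G) \<and> edges G \<subseteq> nsets (verts G) k"

definition subhypergraph :: "'a hypergraph \<Rightarrow> 'a hypergraph \<Rightarrow> bool" where
  "subhypergraph H G \<longleftrightarrow>
     verts H \<subseteq> verts G \<and> edges H \<subseteq> edges G \<and> edges H \<subseteq> Pow (verts H)"

definition isomorphic :: "'a hypergraph \<Rightarrow> 'b hypergraph \<Rightarrow> bool" where
  "isomorphic G H \<longleftrightarrow>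
     (\<exists>f. bij_betw f (verts G) (verts H) \<and> edges H = (\<lambda>e. f ` e) ` edges G)"

datatype colour = Red | Blue

(* A colouring is a total function on vertex sets; only its values on edges G matter. *)
definition arrows :: "'a hypergraph \<Rightarrow> 'b hypergraph \<Rightarrow> bool" where
  "arrows G H \<longleftrightarrow>
     (\<forall>c :: 'a set \<Rightarrow> colour. \<exists>H'. subhypergraph H' G \<and> isomorphic H H' \<and>
        (\<exists>col. \<forall>e\<in>edges H'. c e = col))"

(* Every finite hypergraph has an isomorphic copy with vertices in nat, so letting G range
   over hypergraphs on nat loses nothing. For a k-graph H the set of admissible m is
   nonempty by Ramsey's theorem, hence LEAST is the minimum. *)
definition size_ramsey :: "nat \<Rightarrow> 'b hypergraph \<Rightarrow> nat" where
  "size_ramsey k H =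
     (LEAST m. \<exists>G :: nat hypergraph. kgraph k G \<and> card (edges G) = m \<and> arrows G H)"

(* The representative with vertex ordering 1, ..., n; intended for 1 \<le> k \<le> n,
   where the bound j + k \<le> n + 1 says j \<le> n - k + 1. *)
definition tight_path :: "nat \<Rightarrow> nat \<Rightarrow> nat hypergraph" where
  "tight_path k n =
     \<lparr>verts = {1..n}, edges = {{j..<j + k} | j. 1 \<le> j \<and> j + k \<le> n + 1}\<rparr>"

end

theory Submission
  imports Defs
begin

text \<open>
  Put r = \<lceil>log_2 (k + 1)\<rceil> = c + 2. It suffices to show that a finite family F of k-sets with
  |F| < r n - 2 k^2 has a subfamily H of fewer than n - k + 1 members such that F - H contains no
  tight path on n vertices: colouring H red and the rest blue then leaves no monochromatic path,
  because a red one would need n - k + 1 edges.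

  H is built greedily. If F contains a tight path, let Z be a segment of its vertex sequence. Along
  any tight path the number |f \<inter> Z| changes by at most 1 from one edge f to the next. So after
  deleting the level {f. |f \<inter> Z| = i}, a surviving path stays below the level or above it. It
  cannot stay above it if |Z| < (i + 1) (n div k), since it has n div k disjoint edges. Hence only
  the edges below the level matter from now on, and all h_i edges with |f \<inter> Z| \<ge> i are disposed of
  at the cost of h_i - h_(i+1) edges. This is cheap enough if
  (c + 1) (h_i - h_(i+1)) \<le> min h_i Y, where Y = |F| + k + 2 k^2 - r k - n.

  If no level is cheap, the h_i grow, as i decreases from k, geometrically while they are below Y
  and linearly with slope Y / (c + 1) afterwards, starting from the |Z| - k + 1 path edges
  inside Z. The sum of the h_i, which is the sum of |f \<inter> Z| over f \<in> F, is then too large: averaged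
  over about k / 2 disjoint segments Z of the path it is at most about 2 |F|.
\<close>

section \<open>Sequences without a cheap level\<close>

lemma sum_by_parts_real:
  fixes h :: "nat \<Rightarrow> real"
  assumes "1 \<le> k"
  shows "(\<Sum>i=1..k. h i) = real k * h k + (\<Sum>i=1..<k. real i * (h i - h (Suc i)))"
  using assms
proof (induction k rule: dec_induct)
  case base then show ?case by simp
next
  case (step m)
  have "(\<Sum>i=1..<Suc m. real i * (h i - h (Suc i))) = (\<Sum>i=1..<m. real i * (h i - h (Suc i))) + real m * (h m - h (Suc m))"
    using step.hyps by simp
  then show ?case using step by (simp add: algebra_simps)
qed

text \<open>Summation by parts gives the drop from level i to level i + 1 the weight i. Drops
  outside {a..J} are nonnegative by \<open>anti\<close> and are discarded; the remaining weights sum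
  to a difference of two triangular numbers.\<close>

lemma sum_ge_of_steps:
  fixes h :: "nat \<Rightarrow> real"
  assumes J: "1 \<le> a" "a \<le> J" "J < k"
    and anti: "\<And>i. 1 \<le> i \<Longrightarrow> i < k \<Longrightarrow> h (Suc i) \<le> h i"
    and d: "\<And>i. a \<le> i \<Longrightarrow> i \<le> J \<Longrightarrow> d \<le> h i - h (Suc i)"
  shows "real k * h k + d * ((real J * (real J + 1) - real a * (real a - 1)) / 2) \<le> (\<Sum>i=1..k. h i)"
proof -
  have split: "{1..<k} = {a..J} \<union> ({1..<a} \<union> {J<..<k})" using J by auto
  have gauss: "(\<Sum>i=a..J. real i) = (real J * (real J + 1) - real a * (real a - 1)) / 2"
    using J(2) by (induction J rule: dec_induct) (auto simp: field_simps)
  have "(\<Sum>i=a..J. real i * d) \<le> (\<Sum>i=a..J. real i * (h i - h (Suc i)))"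
    using d by (intro sum_mono mult_left_mono) auto
  moreover have "(\<Sum>i\<in>{1..<a} \<union> {J<..<k}. real i * (h i - h (Suc i))) \<ge> 0"
    using anti J by (intro sum_nonneg mult_nonneg_nonneg) auto
  moreover have "(\<Sum>i=1..<k. real i * (h i - h (Suc i))) = (\<Sum>i=a..J. real i * (h i - h (Suc i)))
      + (\<Sum>i\<in>{1..<a} \<union> {J<..<k}. real i * (h i - h (Suc i)))"
    unfolding split by (rule sum.union_disjoint) auto
  moreover have "(\<Sum>i=a..J. real i * d) = d * ((real J * (real J + 1) - real a * (real a - 1)) / 2)"
    using gauss by (metis sum_distrib_right mult.commute)
  ultimately show ?thesis using sum_by_parts_real[of k h] J by simp
qed

text \<open>The shift by 1 makes \<open>step\<close> multiplicative: going down from k to J, the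
  lower bound for h i + 1 gains a factor 1 + 1 / c per level. Below J, monotonicity preserves the
  bound reached there. The summand \<open>real k\<close> pays for the shifts.\<close>

lemma sum_ge_of_geometric:
  fixes h :: "nat \<Rightarrow> real"
  assumes c: "c > 0" and J: "1 \<le> J" "J \<le> k"
    and anti: "\<And>i. 1 \<le> i \<Longrightarrow> i < k \<Longrightarrow> h (Suc i) \<le> h i"
    and top: "h k + 1 \<ge> l"
    and step: "\<And>i. J \<le> i \<Longrightarrow> i < k \<Longrightarrow> c * (h i + 1) \<ge> (c + 1) * (h (Suc i) + 1)"
  shows "(\<Sum>i=1..k. h i) + real k \<ge> l * ((real J + c) * (1 + 1 / c) ^ (k - J) - c)"
proof -
  let ?q = "1 + 1 / c"
  have q: "h (k - t) + 1 \<ge> l * ?q ^ t" if "t \<le> k - J" for t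
    using that
  proof (induction t)
    case (Suc t)
    have "c * (h (k - Suc t) + 1) \<ge> (c + 1) * (h (Suc (k - Suc t)) + 1)"
      using Suc.prems J by (intro step) auto
    moreover have "Suc (k - Suc t) = k - t" using Suc.prems J by auto
    moreover have "h (k - t) + 1 \<ge> l * ?q ^ t" using Suc by simp
    ultimately have "c * (h (k - Suc t) + 1) \<ge> (c + 1) * (l * ?q ^ t)"
      using c by (smt (verit) mult_left_mono)
    moreover have "(c + 1) * (l * ?q ^ t) = c * (l * ?q ^ Suc t)"
      using c by (simp add: field_simps)
    ultimately show ?case using c by (metis mult_le_cancel_left_pos)
  qed (use top in simp)
  have low: "h i \<ge> h J" if "1 \<le> i" "i \<le> J" for i
    using that(2,1)
  proof (induction i rule: inc_induct)
    case (step m) then show ?case using anti[of m] J by force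
  qed simp
  have s1: "(\<Sum>i\<in>{1..<J}. h i + 1) \<ge> (real J - 1) * (l * ?q ^ (k - J))"
  proof -
    have "(\<Sum>i\<in>{1..<J}. h i + 1) \<ge> (\<Sum>i\<in>{1..<J}. l * ?q ^ (k - J))"
      using low q[of "k - J"] J by (intro sum_mono) fastforce
    then show ?thesis using J by (simp add: of_nat_diff)
  qed
  have s2: "(\<Sum>i\<in>{J..k}. h i + 1) \<ge> l * ((c + 1) * ?q ^ (k - J) - c)"
  proof -
    have "(\<Sum>i\<in>{J..k}. h i + 1) = (\<Sum>t\<in>{..k - J}. h (k - t) + 1)"
      using J by (intro sum.reindex_bij_witness[of _ "\<lambda>t. k - t" "\<lambda>t. k - t"]) auto
    also have "\<dots> \<ge> (\<Sum>t\<in>{..k - J}. l * ?q ^ t)"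
      using q by (intro sum_mono) auto
    also have "(\<Sum>t\<in>{..k - J}. l * ?q ^ t) = l * ((c + 1) * ?q ^ (k - J) - c)"
    proof -
      have "(\<Sum>t\<in>{..m}. ?q ^ t) = (c + 1) * ?q ^ m - c" for m
      proof (induction m)
        case (Suc m)
        have "(c + 1) * y - c + ?q * y = (c + 1) * (?q * y) - c" for y
          using c by (simp add: field_simps)
        then show ?case using Suc by simp
      qed simp
      then show ?thesis by (simp add: sum_distrib_left[symmetric])
    qed
    finally show ?thesis .
  qed
  have "(\<Sum>i\<in>{1..k}. h i + 1) = (\<Sum>i\<in>{1..<J} \<union> {J..k}. h i + 1)"
    using J by (intro sum.cong) auto
  also have "\<dots> = (\<Sum>i\<in>{1..<J}. h i + 1) + (\<Sum>i\<in>{J..k}. h i + 1)"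
    by (rule sum.union_disjoint) auto
  finally have "(\<Sum>i=1..k. h i) + real k = (\<Sum>i\<in>{1..<J}. h i + 1) + (\<Sum>i\<in>{J..k}. h i + 1)"
    by (simp add: sum.distrib)
  moreover have "l * ((real J + c) * ?q ^ (k - J) - c)
      = (real J - 1) * (l * ?q ^ (k - J)) + l * ((c + 1) * ?q ^ (k - J) - c)"
    by (simp add: algebra_simps)
  ultimately show ?thesis using s1 s2 by linarith
qed

section \<open>Exponential against quadratic growth, and the resulting bounds on the level
  sum\<close>

lemma quadratic_le_power_two: "6 \<le> c \<Longrightarrow> c * (2 * c + 2) + c + 1 \<le> (2::nat) ^ (c + 1)"
proof (induction c rule: dec_induct)
  case (step m)
  have "Suc m * (2 * Suc m + 2) + Suc m + 1 \<le> 2 * (m * (2 * m + 2) + m + 1)"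
  proof -
    have "6 * m \<le> m * m" using step.hyps by simp
    then have "m + 4 \<le> 2 * (m * m)" using step.hyps by linarith
    then show ?thesis by (simp add: algebra_simps)
  qed
  then show ?case using step by simp
qed simp

text \<open>Replacing k by k + 1 multiplies the right side by 1 + 1 / c, so it suffices that the
  increment of the left side is at most 1 / c times its value. This holds once k >= 3 c.\<close>

lemma geometric_beats_quadratic_step:
  fixes c k :: nat
  assumes "3 \<le> c" "3 * c \<le> k"
    and "2 * c + (real c - 2) * real k ^ 2 + (3 * real c + 11) * real k
          \<le> 2 * (2 * real c + 1) * (1 + 1 / real c) ^ (k - c - 1)"
  shows "2 * c + (real c - 2) * real (Suc k) ^ 2 + (3 * real c + 11) * real (Suc k)
          \<le> 2 * (2 * real c + 1) * (1 + 1 / real c) ^ (Suc k - c - 1)"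
proof -
  let ?R = "2 * c + (real c - 2) * real k ^ 2 + (3 * real c + 11) * real k"
  have e: "Suc k - c - 1 = Suc (k - c - 1)" using assms by simp
  have kc: "3 * real c \<le> real k" using assms(2) by linarith
  have "(real c - 2) * (3 * real c) * real k \<le> (real c - 2) * real k * real k"
    using kc assms(1) by (intro mult_right_mono mult_left_mono) auto
  moreover have "(3 * real c + 11) * (3 * real c) \<le> (3 * real c + 11) * real k"
    using kc by (intro mult_left_mono) auto
  moreover have "real c * ((real c - 2) * (2 * real k + 1) + 3 * real c + 11)
      \<le> real c * ((real c - 2) * (3 * real k) + (3 * real c + 11) * 3)"
  proof (rule mult_left_mono)
    have "(real c - 2) * (2 * real k + 1) \<le> (real c - 2) * (3 * real k)"
      using assms by (intro mult_left_mono) auto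
    then show "(real c - 2) * (2 * real k + 1) + 3 * real c + 11 \<le> (real c - 2) * (3 * real k) + (3 * real c + 11) * 3"
      by simp
  qed simp
  ultimately have "real c * ((real c - 2) * (2 * real k + 1) + 3 * real c + 11) \<le> ?R"
    by (simp add: algebra_simps power2_eq_square)
  then have "((real c - 2) * (2 * real k + 1) + 3 * real c + 11) \<le> ?R / c"
    using assms(1) by (simp add: field_simps)
  moreover have "2 * c + (real c - 2) * real (Suc k) ^ 2 + (3 * real c + 11) * real (Suc k)
      = ?R + ((real c - 2) * (2 * real k + 1) + 3 * real c + 11)"
    by (simp add: algebra_simps power2_eq_square)
  moreover have "?R * (1 + 1 / c) = ?R + ?R / c" by (simp add: distrib_left)
  ultimately have "2 * c + (real c - 2) * real (Suc k) ^ 2 + (3 * real c + 11) * real (Suc k) \<le> ?R * (1 + 1 / c)"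
    by linarith
  also have "\<dots> \<le> (2 * (2 * real c + 1) * (1 + 1 / real c) ^ (k - c - 1)) * (1 + 1 / c)"
    using assms(3) by (intro mult_right_mono) auto
  finally show ?thesis unfolding e by (simp add: mult_ac)
qed

text \<open>Induction on k from a base point, which is checked numerically for c <= 5. For c = 3 the
  inequality fails at k = 16 and k = 17, hence the bound 18.\<close>

lemma geometric_beats_quadratic:
  fixes c k :: nat
  assumes c: "3 \<le> c" and k: "2 ^ (c + 1) \<le> k" "18 \<le> k"
  shows "2 * c + (real c - 2) * real k ^ 2 + (3 * real c + 11) * real k
          \<le> 2 * (2 * real c + 1) * (1 + 1 / real c) ^ (k - c - 1)" (is "?P k")
proof -
  have ind: "?P k" if "?P b" "b \<le> k" "3 * c \<le> b" for b
    using that(2,1)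
  proof (induction k rule: dec_induct)
    case (step m) then show ?case using geometric_beats_quadratic_step[OF c, of m] that(3) by auto
  qed
  consider "c = 3" | "c = 4" | "c = 5" | "6 \<le> c" using c by linarith
  then show ?thesis
  proof cases
    case 1 show ?thesis by (rule ind[of 18]) (use 1 k in \<open>auto simp: power_divide\<close>)
  next
    case 2 show ?thesis by (rule ind[of 32]) (use 2 k in \<open>auto simp: power_divide\<close>)
  next
    case 3 show ?thesis by (rule ind[of 64]) (use 3 k in \<open>auto simp: power_divide\<close>)
  next
    case 4
    let ?b = "2 ^ (c + 1) :: nat"
    note pb = quadratic_le_power_two[OF 4]
    \<comment> \<open>By Bernoulli every c factors contribute at least 2, so c * (2 * c + 2) factors
      reach \<open>?b\<close> squared. \<open>quadratic_le_power_two\<close> says that the exponent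
      \<open>?b - c - 1\<close> provides that many.\<close>
    have q: "(1 + 1 / real c) ^ c \<ge> 2"
    proof -
      have "1 + real c * (1 / real c) \<le> (1 + 1 / real c) ^ c"
        by (rule Bernoulli_inequality) (rule order_trans[of _ 0], auto)
      then show ?thesis using c by simp
    qed
    have "(real ?b)\<^sup>2 = 2 ^ (2 * c + 2)" by (simp flip: power_mult add: algebra_simps)
    also have "\<dots> \<le> ((1 + 1 / real c) ^ c) ^ (2 * c + 2)" using q by (intro power_mono) auto
    also have "\<dots> = (1 + 1 / real c) ^ (c * (2 * c + 2))" by (simp only: power_mult)
    also have "\<dots> \<le> (1 + 1 / real c) ^ (?b - c - 1)"
      using pb by (intro power_increasing) auto
    finally have X: "(real ?b)\<^sup>2 \<le> (1 + 1 / real c) ^ (?b - c - 1)" .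
    have bn: "6 * c + 3 \<le> ?b"
    proof -
      have "6 * c \<le> c * c" using 4 by simp
      moreover have "c * (2 * c + 2) = 2 * (c * c) + 2 * c" by simp
      ultimately have "6 * c + 3 \<le> c * (2 * c + 2) + c + 1" using 4 by linarith
      then show ?thesis using pb by linarith
    qed
    have bc: "6 * real c + 3 \<le> real ?b"
    proof -
      from bn have "real (6 * c + 3) \<le> real ?b" unfolding of_nat_le_iff .
      then show ?thesis by simp
    qed
    have "2 * real c + (3 * real c + 11) * real ?b \<le> 2 * real ?b * real ?b"
    proof -
      have "2 * real c \<le> real ?b" using bc by linarith
      moreover have "(3 * real c + 11 + 1) * real ?b \<le> (2 * real ?b) * real ?b"
        using bc 4 by (intro mult_right_mono) auto
      ultimately show ?thesis unfolding distrib_right by linarith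
    qed
    then have "2 * c + (real c - 2) * real ?b ^ 2 + (3 * real c + 11) * real ?b \<le> real c * (real ?b)\<^sup>2"
      unfolding left_diff_distrib power2_eq_square of_nat_mult of_nat_numeral by linarith
    also have "\<dots> \<le> 2 * (2 * real c + 1) * (real ?b)\<^sup>2"
      by (intro mult_right_mono) auto
    also have "\<dots> \<le> 2 * (2 * real c + 1) * (1 + 1 / real c) ^ (?b - c - 1)"
      using X by (intro mult_left_mono) auto
    finally show ?thesis by (rule ind) (use k bn in \<open>auto\<close>)
  qed
qed

text \<open>Multiply \<open>T\<close> by G: as 2 * G >= K, the term 2 * G * Y covers K * Y, and K *
  (G * Z) covers K * N up to a quadratic error. By the choice of Y, the sum K * Y + K * N exceeds K
  * F by at least K^3 + K^2, which absorbs the errors, the largest being G * K * (K - 1), about K^3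
  / 2.\<close>

lemma level_sum_large_linear:
  fixes K G R N F Y Z T :: real
  assumes G: "K \<le> 2 * G" "2 * G \<le> K + 1" and K: "4 \<le> K" and R: "R \<le> K"
    and N: "2 * N \<le> 2 * (G * Z) + 3 * K - 2"
    and Y: "Y = F + K + 2 * K\<^sup>2 - R * K - N" "0 \<le> Y"
    and T: "K * (Z - K + 1) + 2 * (Y + 1) \<le> T"
  shows "K * F < G * T"
proof -
  have "G * (K * (Z - K + 1) + 2 * (Y + 1)) \<le> G * T"
    using T G K by (intro mult_left_mono) auto
  moreover have "K * Y \<le> 2 * G * Y" using G Y by (intro mult_right_mono) auto
  moreover have "K * (2 * N) \<le> K * (2 * (G * Z) + 3 * K - 2)"
    using N K by (intro mult_left_mono) auto
  moreover have "2 * G * (K * K - K - 2) \<le> (K + 1) * (K * K - K - 2)"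
  proof -
    have "4 * K \<le> K * K" using K by simp
    then have "0 \<le> K * K - K - 2" using K by linarith
    then show ?thesis using G by (intro mult_right_mono) auto
  qed
  moreover have "R * (K * K) \<le> K * (K * K)" using R by (intro mult_right_mono) auto
  moreover have "K * K \<le> K * (K * K)" using K by simp
  moreover have "K * F = K * Y - K * K - 2 * (K * (K * K)) + R * (K * K) + K * N"
    unfolding Y(1) by (simp add: algebra_simps power2_eq_square)
  ultimately show ?thesis
    using K by (simp only: algebra_simps)
qed

text \<open>Here X stands for (1 + 1 / c)^(k - c - 1) and l for z - k + 2. After the bounds on F and
  N are inserted, the estimate is linear in l with a nonnegative coefficient, so l = 2 is the worst
  case.\<close>

lemma level_sum_large_geometric:
  fixes K G c N F l A T X :: real
  assumes G: "K \<le> 2 * G" "2 * G \<le> K + 1" and K: "3 * c + 10 \<le> 4 * K" "0 < K" and c: "2 \<le> c"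
    and N: "2 * N \<le> 2 * (G * (l + K - 2)) + 3 * K - 2"
    and F: "F + 2 * K\<^sup>2 + 1 \<le> (c + 2) * N"
    and l: "2 \<le> l"
    and X: "2 * c + (c - 2) * K\<^sup>2 + (3 * c + 11) * K \<le> 2 * (2 * c + 1) * X"
    and T: "l * ((2 * c + 1) * X - c) \<le> T + K"
  shows "K * F < G * T"
proof -
  let ?R = "c + 2"
  \<comment> \<open>The lower bound for 2 * (G * T - K * F) contains l only in 2 * G * l *
    \<open>?B\<close>. Once l * \<open>?B\<close> is replaced by its lower bound \<open>?S\<close>,
    the terms with G combine to -2 * G * \<open>?M\<close>.\<close>
  let ?B = "(2 * c + 1) * X - c - K * ?R"
  let ?M = "4 * (K * K) - 3 * (?R * K) - 4 * K"
  have M: "0 \<le> ?M"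
    using K mult_left_mono[of "3 * c + 10" "4 * K" K] by (simp add: algebra_simps)
  have "2 * G * ?M \<le> (K + 1) * ?M" using G M by (intro mult_right_mono) auto
  also have "\<dots> < 4 * (K * (K * K)) + 2 * K - 3 * (?R * (K * K)) + 2 * (?R * K)"
  proof -
    have "(K + 1) * ?M = 4 * (K * (K * K)) - 3 * (?R * (K * K)) - 3 * (?R * K) - 4 * K"
      by (simp add: algebra_simps)
    moreover have "0 < ?R * K" using c K by simp
    ultimately show ?thesis using K by linarith
  qed
  finally have GM: "2 * (G * ?M) < 4 * (K * (K * K)) + 2 * K - 3 * (?R * (K * K)) + 2 * (?R * K)" by simp
  let ?S = "(c - 2) * (K * K) + (c + 7) * K"
  have B: "?S \<le> 2 * ?B"
    using X by (simp add: algebra_simps power2_eq_square)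
  have "0 \<le> ?S" using c K by simp
  then have "0 \<le> 2 * ?B" using B by (rule order_trans)
  then have "2 * ?B \<le> l * ?B" using l by (intro mult_right_mono) auto
  with B have "?S \<le> l * ?B" by (rule order_trans)
  then have "G * ?S \<le> G * (l * ?B)" using G K by (intro mult_left_mono) auto
  moreover have "G * (l * ((2 * c + 1) * X - c)) \<le> G * (T + K)"
    using T G K by (intro mult_left_mono) auto
  moreover have "K * (F + 2 * K\<^sup>2 + 1) \<le> K * (?R * N)"
    using F K by (intro mult_left_mono) auto
  moreover have "K * ?R * (2 * N) \<le> K * ?R * (2 * (G * (l + K - 2)) + 3 * K - 2)"
    using N K c by (intro mult_left_mono) auto
  ultimately show ?thesis using GM
    by (simp add: algebra_simps power2_eq_square)
qed

text \<open>
  Here f is the number of edges, g the number of segments, z their length, h i the number of edges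
  with at least i vertices in the segment; no level i \<ge> a is cheap. The case a = 2 is needed for
  even k and 2 n < k^2 + 2 k: then n div k = k div 2, and a segment of length at least k does not
  satisfy the bound (i + 1) (n div k) for i = 1.
\<close>

lemma level_sum_large:
  fixes h :: "nat \<Rightarrow> real" and Y :: real and a k c g z n f :: nat
  assumes a: "a = 1 \<or> a = 2 \<and> 3 \<le> c"
    and k4: "4 \<le> k" and c: "1 \<le> c" "2 ^ (c + 1) \<le> k" "k < 2 ^ (c + 2)"
    and g: "k \<le> 2 * g" "2 * g \<le> k + 1"
    and z: "k \<le> z" "even k \<Longrightarrow> k + 1 \<le> z"
    and n: "2 * n + 2 \<le> 2 * (g * z) + 3 * k" "odd k \<Longrightarrow> n + 1 \<le> g * z + k"
    and f: "f + 2 * k\<^sup>2 + 1 \<le> (c + 2) * n" "n + 1 \<le> f + k"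
    and Y: "Y = real f + real k + 2 * (real k)\<^sup>2 - (real c + 2) * real k - real n"
    and anti: "\<And>i. 1 \<le> i \<Longrightarrow> i < k \<Longrightarrow> h (Suc i) \<le> h i"
    and top: "real z - real k + 1 \<le> h k"
    and bad: "\<And>i. a \<le> i \<Longrightarrow> i < k \<Longrightarrow> min (h i) Y + 1 \<le> (real c + 1) * (h i - h (Suc i))"
  shows "real k * real f < real g * (\<Sum>i=1..k. h i)"
proof -
  define T where "T = (\<Sum>i=1..k. h i)"
  define l where "l = real z - real k + 2"
  \<comment> \<open>If the linear regime is reached at level J or above, then 4 (c + 1) + a (a - 1) \<le> J (J + 1)
    makes the sum large enough; otherwise the growth is geometric all the way from k to J.\<close>
  define J where "J = (if c = 1 then 3 else c + 1)"
  have c1: "c + 2 \<le> 2 ^ (c + 1)" for c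
    by (induction c) auto
  have ck: "c + 2 \<le> k" using c1[of c] c by linarith
  have J: "3 \<le> J" "J < k" "4 * (c + 1) + a * (a - 1) \<le> J * (J + 1)"
  proof -
    have "4 * (c + 1) \<le> (c + 2) * (c + 1)" if "c \<noteq> 1"
      using that c(1) by (intro mult_right_mono) auto
    moreover have "c + 4 \<le> c * c" if "3 \<le> c"
      using that mult_le_mono1[of 3 c c] by linarith
    ultimately show "3 \<le> J" "J < k" "4 * (c + 1) + a * (a - 1) \<le> J * (J + 1)"
      using ck k4 c a by (auto simp: J_def mult.commute)
  qed
  have aJ: "1 \<le> a" "a < J" using a J(1) by auto
  have F: "real f + 2 * (real k)\<^sup>2 + 1 \<le> (real c + 2) * real n" "real n + 1 \<le> real f + real k"
  proof -
    have "real (f + 2 * k\<^sup>2 + 1) \<le> real ((c + 2) * n)" "real (n + 1) \<le> real (f + k)"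
      using f unfolding of_nat_le_iff by auto
    then show "real f + 2 * (real k)\<^sup>2 + 1 \<le> (real c + 2) * real n" "real n + 1 \<le> real f + real k"
      by (auto simp: algebra_simps)
  qed
  have N: "2 * real n \<le> 2 * (real g * real z) + 3 * real k - 2"
  proof -
    have "real (2 * n + 2) \<le> real (2 * (g * z) + 3 * k)" using n(1) unfolding of_nat_le_iff .
    then show ?thesis by simp
  qed
  have No: "real n \<le> real g * real z + real k - 1" if "odd k"
  proof -
    have "real (n + 1) \<le> real (g * z + k)" using n(2)[OF that] unfolding of_nat_le_iff .
    then show ?thesis by simp
  qed
  have l: "2 \<le> l" "even k \<Longrightarrow> 3 \<le> l" using z by (auto simp: l_def)
  have zl: "real z = l + real k - 2" by (simp add: l_def)
  have G: "real k \<le> 2 * real g" "2 * real g \<le> real k + 1" using g by linarith+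
  have Y0: "0 \<le> Y"
  proof -
    have "(real c + 2) * real k \<le> real k * real k" using ck by (intro mult_right_mono) auto
    moreover have "0 \<le> real k * real k" by simp
    ultimately show ?thesis using F(2) unfolding Y power2_eq_square by linarith
  qed
  have low: "h j \<le> h i" if "1 \<le> i" "i \<le> j" "j \<le> k" for i j
    using that(2,1,3)
  proof (induction i rule: inc_induct)
    case (step m) then show ?case using anti[of m] by force
  qed simp
  show ?thesis
  proof (cases "Y \<le> h J")
    case True
    have "(Y + 1) / (real c + 1) \<le> h i - h (Suc i)" if "a \<le> i" "i \<le> J" for i
    proof -
      have "min (h i) Y = Y" using True low[of i J] that J aJ by simp
      then show ?thesis using bad[of i] that J by (simp add: field_simps)
    qed
    then have *: "real k * h k + (Y + 1) / (real c + 1) * ((real J * (real J + 1) - real a * (real a - 1)) / 2) \<le> T"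
      unfolding T_def using sum_ge_of_steps[of a J k h "(Y + 1) / (real c + 1)"] J aJ anti by simp
    have "real (4 * (c + 1) + a * (a - 1)) \<le> real (J * (J + 1))" using J(3) unfolding of_nat_le_iff .
    then have "2 \<le> (real J * (real J + 1) - real a * (real a - 1)) / 2 / (real c + 1)"
      using aJ by (simp add: field_simps of_nat_diff)
    then have "(Y + 1) * 2 \<le> (Y + 1) * ((real J * (real J + 1) - real a * (real a - 1)) / 2 / (real c + 1))"
      using Y0 by (intro mult_left_mono) auto
    moreover have "real k * (real z - real k + 1) \<le> real k * h k" using top by (intro mult_left_mono) auto
    ultimately have "real k * (real z - real k + 1) + 2 * (Y + 1) \<le> T" using * by (simp add: mult_ac)
    then show ?thesis unfolding T_def[symmetric]
      using level_sum_large_linear[OF G _ _ N Y Y0] k4 ck by simp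
  next
    case False
    \<comment> \<open>From J upwards the minimum in \<open>bad\<close> is h i, and its + 1 turns the
      inequality into growth of h i + 1 by the factor (c + 1) / c.\<close>
    have step: "real c * (h i + 1) \<ge> (real c + 1) * (h (Suc i) + 1)" if "J \<le> i" "i < k" for i
    proof -
      have "min (h i) Y = h i" using False low[of J i] that J by simp
      then show ?thesis using bad[of i] that aJ by (simp add: algebra_simps)
    qed
    have top': "l \<le> h k + 1" using top by (simp add: l_def)
    have geo: "l * ((real J + real c) * (1 + 1 / real c) ^ (k - J) - real c) \<le> T + real k"
      unfolding T_def using sum_ge_of_geometric[of "real c" J k h l] c J anti top' step by force
    \<comment> \<open>\<open>geometric_beats_quadratic\<close> covers k >= 18; below that the power
      in \<open>geo\<close> is evaluated. For k = 16 and k = 17 this succeeds thanks to l >= 3 and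
      \<open>No\<close> respectively. For k = 4 and k = 8 \<open>geo\<close> alone is too weak, so
      the levels 1 and 2 below J are used as well.\<close>
    consider (four) "k = 4" "c = 1" | (eight) "k = 8" "c = 2" | (large) "18 \<le> k" | (small) "k \<in> {5, 6, 7} \<and> c = 1 \<or> k \<in> {9, 10, 11, 12, 13, 14, 15} \<and> c = 2 \<or> k \<in> {16, 17} \<and> c = 3"
    proof -
      have "c = 1" if "k < 8"
        using c(1,2) that power_increasing[of 3 "c + 1" "2::nat"] by (cases "c = 1") auto
      moreover have "c = 2" if "8 \<le> k" "k < 16"
        using c that power_increasing[of 4 "c + 1" "2::nat"] by (cases "c = 1"; cases "c = 2") auto
      moreover have "c = 3" if "16 \<le> k" "k < 18"
        using c that power_increasing[of 5 "c + 1" "2::nat"] by (cases "c = 1"; cases "c = 2"; cases "c = 3") auto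
      moreover have "18 \<le> k \<or> k = 4 \<or> k = 5 \<or> k = 6 \<or> k = 7 \<or> k = 8 \<or> k = 9 \<or> k = 10 \<or> k = 11 \<or> k = 12 \<or> k = 13 \<or> k = 14 \<or> k = 15 \<or> k = 16 \<or> k = 17"
        using k4 by presburger
      ultimately show ?thesis using that by (elim disjE) simp_all
    qed
    then have "real k * real f < real g * T"
    proof cases
      case large
      have c3: "3 \<le> c"
      proof (rule ccontr)
        assume "\<not> 3 \<le> c"
        then have "2 ^ (c + 2) \<le> (2::nat) ^ 4" by (intro power_increasing) auto
        then show False using large c by simp
      qed
      then have "J = c + 1" by (simp add: J_def)
      with geo have "l * ((2 * real c + 1) * (1 + 1 / real c) ^ (k - c - 1) - real c) \<le> T + real k"
        by (simp add: algebra_simps)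
      with level_sum_large_geometric[OF G _ _ _ N[unfolded zl] F(1) l(1)] geometric_beats_quadratic[OF c3 c(2) large]
      show ?thesis using c3 ck large by simp
    next
      case small
      moreover have "g = (k + 1) div 2" using g by linarith
      ultimately show ?thesis
        using geo F(1) N No l unfolding zl J_def
        by - (elim disjE conjE insertE emptyE; simp add: power_divide)
    next
      case four
      have gk: "g = 2" using g four by linarith
      have T: "T = h 1 + h 2 + h 3 + h 4"
        unfolding T_def four by (simp add: numeral_eq_Suc)
      have s1: "min (h 1) Y + 1 \<le> 2 * (h 1 - h 2)"
        using bad[of 1] a unfolding four by (simp add: numeral_eq_Suc)
      have s2: "min (h 2) Y + 1 \<le> 2 * (h 2 - h 3)"
        using bad[of 2] a unfolding four by (simp add: numeral_eq_Suc)
      have s3: "2 * (h 4 + 1) \<le> 1 * (h 3 + 1)"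
        using step[of 3] unfolding J_def four by (simp add: numeral_eq_Suc)
      have a: "h 2 \<le> h 1"
        using anti[of 1] four by (simp add: numeral_eq_Suc)
      show ?thesis
        using s1 s2 s3 a top' F N l G Y T unfolding zl four gk
        by (cases "h 1 \<le> Y"; cases "h 2 \<le> Y"; simp add: min_def)
    next
      case eight
      have gk: "g = 4" using g eight by linarith
      have T: "T = h 1 + h 2 + h 3 + h 4 + h 5 + h 6 + h 7 + h 8"
        unfolding T_def eight by (simp add: numeral_eq_Suc)
      have s1: "min (h 1) Y + 1 \<le> 3 * (h 1 - h 2)"
        using bad[of 1] a unfolding eight by (simp add: numeral_eq_Suc)
      have s2: "min (h 2) Y + 1 \<le> 3 * (h 2 - h 3)"
        using bad[of 2] a unfolding eight by (simp add: numeral_eq_Suc)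
      have s3: "3 * (h 4 + 1) \<le> 2 * (h 3 + 1)"
        using step[of 3] unfolding J_def eight by (simp add: numeral_eq_Suc)
      have s4: "3 * (h 5 + 1) \<le> 2 * (h 4 + 1)"
        using step[of 4] unfolding J_def eight by (simp add: numeral_eq_Suc)
      have s5: "3 * (h 6 + 1) \<le> 2 * (h 5 + 1)"
        using step[of 5] unfolding J_def eight by (simp add: numeral_eq_Suc)
      have s6: "3 * (h 7 + 1) \<le> 2 * (h 6 + 1)"
        using step[of 6] unfolding J_def eight by (simp add: numeral_eq_Suc)
      have s7: "3 * (h 8 + 1) \<le> 2 * (h 7 + 1)"
        using step[of 7] unfolding J_def eight by (simp add: numeral_eq_Suc)
      have a: "h 2 \<le> h 1"
        using anti[of 1] eight by (simp add: numeral_eq_Suc)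
      show ?thesis
        using s1 s2 s3 s4 s5 s6 s7 a top' F N l G Y T unfolding zl eight gk
        by (cases "h 1 \<le> Y"; cases "h 2 \<le> Y"; simp add: min_def)
    qed
    then show ?thesis unfolding T_def .
  qed
qed

section \<open>Cutting paths along a segment\<close>

text \<open>A bare family of edges replaces the hypergraph because edges are deleted repeatedly; for
  1 <= k <= n the edges cover all the vertices x j. Indices start at 0, unlike in
  \<open>tight_path\<close>.\<close>

definition contains_path :: "nat \<Rightarrow> nat \<Rightarrow> 'a set set \<Rightarrow> bool" where
  "contains_path k n F \<longleftrightarrow>
     (\<exists>x. inj_on x {..<n} \<and> (\<forall>j. j + k \<le> n \<longrightarrow> x ` {j..<j + k} \<in> F))"

section \<open>Counting along a path, and averaging\<close>

lemma card_windows: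
  fixes x :: "nat \<Rightarrow> 'a"
  assumes "inj_on x {..<n}" "a + z \<le> n" "1 \<le> k" "k \<le> z"
  shows "card ((\<lambda>t. x ` {a + t..<a + t + k}) ` {..z - k}) = z - k + 1"
proof -
  have "inj_on (\<lambda>t. x ` {a + t..<a + t + k}) {..z - k}"
  proof (rule inj_onI)
    fix s t assume *: "s \<in> {..z - k}" "t \<in> {..z - k}" "x ` {a + s..<a + s + k} = x ` {a + t..<a + t + k}"
    have "{a + s..<a + s + k} \<subseteq> {..<n}" "{a + t..<a + t + k} \<subseteq> {..<n}" using * assms by auto
    then have "{a + s..<a + s + k} = {a + t..<a + t + k}"
      using inj_on_image_eq_iff[OF assms(1)] *(3) by blast
    then show "s = t" using assms(3) by (simp add: Ico_eq_Ico)
  qed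
  then show ?thesis by (simp add: card_image)
qed

lemma card_ge_of_contains_path:
  assumes "contains_path k n F" "finite F" "1 \<le> k" "k \<le> n"
  shows "n + 1 \<le> card F + k"
proof -
  obtain x where x: "inj_on x {..<n}" "\<And>j. j + k \<le> n \<Longrightarrow> x ` {j..<j + k} \<in> F"
    using assms(1) unfolding contains_path_def by blast
  have "card ((\<lambda>t. x ` {0 + t..<0 + t + k}) ` {..n - k}) \<le> card F"
    using x(2) assms by (intro card_mono) auto
  then show ?thesis using card_windows[OF x(1), of 0 n k] assms by simp
qed

lemma sum_card_level_sets:
  assumes "finite F" "\<And>e. e \<in> F \<Longrightarrow> \<mu> e \<le> k"
  shows "(\<Sum>i=1..k. card {e \<in> F. i \<le> \<mu> e}) = (\<Sum>e\<in>F. \<mu> e)"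
proof -
  have "(\<Sum>i=1..k. card {e \<in> F. i \<le> \<mu> e}) = (\<Sum>i=1..k. \<Sum>e\<in>F. of_bool (i \<le> \<mu> e))"
    using assms(1) by (simp add: Int_def)
  also have "\<dots> = (\<Sum>e\<in>F. \<Sum>i=1..k. of_bool (i \<le> \<mu> e))"
    by (rule sum.swap)
  also have "\<dots> = (\<Sum>e\<in>F. \<mu> e)"
  proof (rule sum.cong)
    fix e assume "e \<in> F"
    then have "{1..k} \<inter> {i. i \<le> \<mu> e} = {1..\<mu> e}" using assms(2)[of e] by auto
    then show "(\<Sum>i=1..k. of_bool (i \<le> \<mu> e)) = \<mu> e" by simp
  qed simp
  finally show ?thesis .
qed

lemma exists_le_average:
  fixes T :: "nat \<Rightarrow> nat"
  assumes "0 < g" "(\<Sum>s<g. T s) \<le> M"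
  obtains s where "s < g" "g * T s \<le> M"
proof -
  have "\<exists>s<g. g * T s \<le> M"
  proof (rule ccontr)
    assume "\<not> (\<exists>s<g. g * T s \<le> M)"
    then have "(\<Sum>s<g. M) < (\<Sum>s<g. g * T s)" using assms(1) by (intro sum_strict_mono) auto
    then show False using assms by (simp flip: sum_distrib_left)
  qed
  then show thesis using that by blast
qed

text \<open>Three demands compete: g segments of length z fit into the path, they miss fewer than 3
  k / 2 of its vertices, and z is small enough for every level i >= a to be cut. With p = n div k,
  the largest length admissible for a = 1 is 2 p - 1.\<close>

lemma segment_parameters:
  fixes k c n :: nat
  assumes k4: "4 \<le> k" and c: "1 \<le> c" "2 ^ (c + 1) \<le> k" "k < 2 ^ (c + 2)"
    and n: "k * k + k \<le> 2 * n" "2 * (k * k) + 2 \<le> (c + 1) * n + k"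
  obtains a g z where "a = 1 \<or> a = 2 \<and> 3 \<le> c" "k \<le> 2 * g" "2 * g \<le> k + 1" "g * z \<le> n"
    "k \<le> z" "even k \<Longrightarrow> k + 1 \<le> z" "z < (a + 1) * (n div k)"
    "2 * n + 2 \<le> 2 * (g * z) + 3 * k" "odd k \<Longrightarrow> n + 1 \<le> g * z + k"
proof -
  define p where "p = n div k"
  have np: "k * p \<le> n" "n < k * p + k"
    using k4 dividend_less_times_div[of k n] unfolding p_def by simp_all
  show thesis
  proof (cases "odd k")
    case True
    then obtain g' where g': "k = 2 * g' + 1" by (rule oddE)
    define g where "g = g' + 1"
    have g: "k + 1 = 2 * g" "2 \<le> g" using g' k4 by (auto simp: g_def)
    have "2 * (k * g) = k * k + k" using g(1) by (metis add_mult_distrib2 mult.left_commute mult.right_neutral)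
    then have kg: "k * g \<le> n" using n(1) by linarith
    have pg: "g \<le> p" unfolding p_def using kg k4 by (simp add: less_eq_div_iff_mult_less_eq mult.commute)
    show thesis
    \<comment> \<open>The longest length that g segments permit is taken, unless it exceeds 2 p -
      1.\<close>
    proof (cases "n div g \<le> 2 * p - 1")
      case less: True
      have gz: "g * (n div g) \<le> n" "n < g * (n div g) + g"
        using g dividend_less_times_div[of g n] by simp_all
      have "k \<le> n div g" using kg g by (simp add: less_eq_div_iff_mult_less_eq)
      then show thesis
        using gz g less pg True by (intro that[of 1 g "n div g"]) (auto simp: p_def)
    next
      case False
      have "g * (2 * p - 1) \<le> g * (n div g)" using False by (intro mult_left_mono) auto
      also have "\<dots> \<le> n" by simp
      finally have "g * (2 * p - 1) \<le> n" .
      moreover have "g * (2 * p - 1) + g = g * (2 * p)" using pg g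
        by (metis (no_types, lifting) add_mult_distrib2 le_add_diff_inverse2 mult.right_neutral mult_le_mono one_le_numeral nat_le_linear le_trans one_le_mult_iff)
      moreover have "g * (2 * p) = k * p + p" using g(1) by (metis add_mult_distrib mult.assoc mult.commute mult_1)
      ultimately show thesis
        using np g pg True by (intro that[of 1 g "2 * p - 1"]) (auto simp: p_def[symmetric])
    qed
  next
    case False
    then obtain g where g: "k = 2 * g" by auto
    have g2: "2 \<le> g" using g k4 by simp
    have n': "2 * (g * g) + g \<le> n" using n(1) unfolding g by simp
    show thesis
    proof (cases "k * (g + 1) \<le> n")
      case True
      then have pg: "g + 1 \<le> p" unfolding p_def using k4 by (simp add: less_eq_div_iff_mult_less_eq mult.commute)
      have *: "g * (2 * p - 1) + g = k * p"
      proof -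
        obtain q where "p = Suc q" using pg by (cases p) auto
        then show ?thesis unfolding g by simp
      qed
      have "2 * p - 1 < (1 + 1) * (n div k)" unfolding p_def[symmetric] using pg by simp
      then show thesis
        using np g pg * False by (intro that[of 1 g "2 * p - 1"]) auto
    next
      \<comment> \<open>Now k^2 + k <= 2 n < k^2 + 2 k, so n div k = k div 2 and only a = 2 admits z
        = k + 1. The second bound on n excludes c = 1 and c = 2.\<close>
      case gap: False
      have "c \<noteq> 1"
      proof
        assume "c = 1"
        then have "k \<in> {4, 6}" using c k4 False by (auto elim!: evenE)
        then show False using n gap g \<open>c = 1\<close> by auto
      qed
      moreover have "c \<noteq> 2"
      proof
        assume c2: "c = 2"
        then have "4 \<le> g" "g < 8" using c g by auto
        then have "g \<in> {4, 5, 6, 7}" by auto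
        then show False using n gap c2 unfolding g by auto
      qed
      ultimately have c3: "3 \<le> c" using c by linarith
      have pg: "g \<le> p" unfolding p_def using n' g g2 by (simp add: less_eq_div_iff_mult_less_eq)
      then have "k + 1 < (2 + 1) * (n div k)" using g g2 unfolding p_def[symmetric] by simp
      then show thesis
        using c3 n' gap False g g2 by (intro that[of 2 g "k + 1"]) (auto simp: algebra_simps)
    qed
  qed
qed

text \<open>An edge meets the g disjoint segments in at most k vertices altogether, so some segment
  has g times its level sum at most k |F|. If it had no cheap level, \<open>level_sum_large\<close>
  would contradict this. The last two conclusions compare the level with the two members of the
  minimum of h i and Y; the positive count makes the later induction descend.\<close>

lemma good_cut:
  fixes F :: "'a set set" and k c n :: nat
  assumes k4: "4 \<le> k" and c: "1 \<le> c" "2 ^ (c + 1) \<le> k" "k < 2 ^ (c + 2)"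
    and n: "k * k + k \<le> 2 * n"
    and F: "finite F" "\<And>e. e \<in> F \<Longrightarrow> finite e \<and> card e = k" "contains_path k n F"
    and f: "card F + 2 * k\<^sup>2 + 1 \<le> (c + 2) * n"
  obtains Z i where "finite Z" "1 \<le> i" "card Z < (i + 1) * (n div k)"
    "1 \<le> card {e \<in> F. i \<le> card (e \<inter> Z)}"
    "(c + 1) * card {e \<in> F. card (e \<inter> Z) = i} \<le> card {e \<in> F. i \<le> card (e \<inter> Z)}"
    "(c + 1) * card {e \<in> F. card (e \<inter> Z) = i} + (c + 2) * k + n \<le> card F + k + 2 * k\<^sup>2"
proof -
  obtain x where x: "inj_on x {..<n}" "\<And>j. j + k \<le> n \<Longrightarrow> x ` {j..<j + k} \<in> F"
    using F(3) unfolding contains_path_def by blast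
  have "k \<le> n" using n k4 mult_le_mono1[of 4 k k] by linarith
  then have nF: "n + 1 \<le> card F + k" using card_ge_of_contains_path[OF F(3,1)] k4 by simp
  then have "2 * (k * k) + 2 \<le> (c + 1) * n + k" using f by (simp add: power2_eq_square)
  then obtain a g z where a: "a = 1 \<or> a = 2 \<and> 3 \<le> c" and g: "k \<le> 2 * g" "2 * g \<le> k + 1"
    and gz: "g * z \<le> n" and z: "k \<le> z" "even k \<Longrightarrow> k + 1 \<le> z" "z < (a + 1) * (n div k)"
    and nz: "2 * n + 2 \<le> 2 * (g * z) + 3 * k" "odd k \<Longrightarrow> n + 1 \<le> g * z + k"
    using segment_parameters[OF k4 c n] by metis
  define Z where "Z = (\<lambda>s. x ` {s * z..<s * z + z})"
  define h where "h = (\<lambda>s i. card {e \<in> F. i \<le> card (e \<inter> Z s)})"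
  have seg: "s * z + z \<le> n" if "s < g" for s
  proof -
    have "(s + 1) * z \<le> g * z" using that by (intro mult_right_mono) auto
    then show ?thesis using gz by (simp add: algebra_simps)
  qed
  have disj: "Z s \<inter> Z t = {}" if "s < t" "t < g" for s t
  proof -
    have "(s + 1) * z \<le> t * z" using that by (intro mult_right_mono) auto
    then have "{s * z..<s * z + z} \<inter> {t * z..<t * z + z} = {}" by auto
    moreover have "{s * z..<s * z + z} \<subseteq> {..<n}" "{t * z..<t * z + z} \<subseteq> {..<n}"
      using seg[of s] seg[of t] that by auto
    ultimately show ?thesis
      unfolding Z_def using inj_on_image_Int[OF x(1)] by (metis image_empty)
  qed
  have disj': "Z s \<inter> Z t = {}" if "s < g" "t < g" "s \<noteq> t" for s t
    using disj[of s t] disj[of t s] that by (cases "s < t") (auto simp: Int_commute)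
  have le_k: "card (e \<inter> Z s) \<le> k" if "e \<in> F" for e s
    using F(2)[OF that] card_mono[of e "e \<inter> Z s"] by simp
  have "(\<Sum>s<g. card (e \<inter> Z s)) \<le> k" if "e \<in> F" for e
  proof -
    have "(\<Sum>s<g. card (e \<inter> Z s)) = card (\<Union>s<g. e \<inter> Z s)"
      using F(2)[OF that] disj' by (intro card_UN_disjoint[symmetric]) blast+
    also have "\<dots> \<le> card e" using F(2)[OF that] by (intro card_mono) auto
    finally show ?thesis using F(2)[OF that] by simp
  qed
  then have "(\<Sum>e\<in>F. \<Sum>s<g. card (e \<inter> Z s)) \<le> (\<Sum>e\<in>F. k)" by (rule sum_mono)
  moreover have "(\<Sum>i=1..k. h s i) = (\<Sum>e\<in>F. card (e \<inter> Z s))" for s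
    unfolding h_def using F(1) le_k by (intro sum_card_level_sets)
  moreover have "(\<Sum>s<g. \<Sum>e\<in>F. card (e \<inter> Z s)) = (\<Sum>e\<in>F. \<Sum>s<g. card (e \<inter> Z s))"
    by (rule sum.swap)
  ultimately have "(\<Sum>s<g. \<Sum>i=1..k. h s i) \<le> k * card F"
    by (simp add: mult.commute)
  then obtain s where s: "s < g" "g * (\<Sum>i=1..k. h s i) \<le> k * card F"
    using exists_le_average[of g "\<lambda>s. \<Sum>i=1..k. h s i" "k * card F"] g k4 by auto
  have top: "z - k + 1 \<le> h s k"
  proof -
    have "card ((\<lambda>t. x ` {s * z + t..<s * z + t + k}) ` {..z - k}) \<le> h s k"
      unfolding h_def
    proof (intro card_mono image_subsetI CollectI conjI)
      fix t assume t: "t \<in> {..z - k}"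
      then have tz: "s * z + t + k \<le> s * z + z" using z(1) by auto
      then show e: "x ` {s * z + t..<s * z + t + k} \<in> F" using seg[OF s(1)] by (intro x(2)) linarith
      have "x ` {s * z + t..<s * z + t + k} \<subseteq> Z s" unfolding Z_def using tz by (intro image_mono) auto
      then have "x ` {s * z + t..<s * z + t + k} \<inter> Z s = x ` {s * z + t..<s * z + t + k}" by blast
      then show "k \<le> card (x ` {s * z + t..<s * z + t + k} \<inter> Z s)" using F(2)[OF e] by simp
    qed (use F(1) in auto)
    then show ?thesis using card_windows[OF x(1) seg[OF s(1)]] z(1) k4 by simp
  qed
  have anti: "h s (Suc i) \<le> h s i" for i
    unfolding h_def using F(1) by (intro card_mono) auto
  have level: "h s i = h s (Suc i) + card {e \<in> F. card (e \<inter> Z s) = i}" for i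
  proof -
    have "{e \<in> F. i \<le> card (e \<inter> Z s)} = {e \<in> F. Suc i \<le> card (e \<inter> Z s)} \<union> {e \<in> F. card (e \<inter> Z s) = i}"
      by auto
    then show ?thesis unfolding h_def using F(1) by (subst card_Un_disjoint[symmetric]) auto
  qed
  have pos: "1 \<le> h s i" if "i < k" for i
  proof -
    have "h s k \<le> h s i" unfolding h_def using F(1) that by (intro card_mono) auto
    then show ?thesis using top by simp
  qed
  define Y where "Y = real (card F) + real k + 2 * (real k)\<^sup>2 - (real c + 2) * real k - real n"
  have "\<exists>i. a \<le> i \<and> i < k \<and> (c + 1) * card {e \<in> F. card (e \<inter> Z s) = i} \<le> h s i \<and>
      (c + 1) * card {e \<in> F. card (e \<inter> Z s) = i} + (c + 2) * k + n \<le> card F + k + 2 * k\<^sup>2"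
  proof (rule ccontr)
    assume none: "\<not> ?thesis"
    have "min (real (h s i)) Y + 1 \<le> (real c + 1) * (real (h s i) - real (h s (Suc i)))"
      if i: "a \<le> i" "i < k" for i
    proof -
      let ?L = "card {e \<in> F. card (e \<inter> Z s) = i}"
      have L: "real (h s i) - real (h s (Suc i)) = real ?L" using level[of i] by simp
      \<comment> \<open>An inequality of integers fails by at least 1, which yields the + 1 that
        \<open>level_sum_large\<close> expects.\<close>
      from none i consider "h s i + 1 \<le> (c + 1) * ?L"
        | "card F + k + 2 * k\<^sup>2 + 1 \<le> (c + 1) * ?L + (c + 2) * k + n"
        by fastforce
      then show ?thesis
      proof cases
        case 1
        then have "real (h s i + 1) \<le> real ((c + 1) * ?L)" unfolding of_nat_le_iff .
        then show ?thesis unfolding L by (simp add: algebra_simps)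
      next
        case 2
        then have "real (card F + k + 2 * k\<^sup>2 + 1) \<le> real ((c + 1) * ?L + (c + 2) * k + n)"
          unfolding of_nat_le_iff .
        then show ?thesis unfolding L Y_def by (simp add: algebra_simps)
      qed
    qed
    moreover have "real z - real k + 1 \<le> real (h s k)" using top z(1) by linarith
    ultimately have "real k * real (card F) < real g * (\<Sum>i=1..k. real (h s i))"
      using anti by (intro level_sum_large[OF a k4 c g z(1,2) nz f nF Y_def]) auto
    moreover have "real (g * (\<Sum>i=1..k. h s i)) \<le> real (k * card F)" using s(2) unfolding of_nat_le_iff .
    ultimately show False by simp
  qed
  then obtain i where i: "a \<le> i" "i < k" "(c + 1) * card {e \<in> F. card (e \<inter> Z s) = i} \<le> h s i"
    "(c + 1) * card {e \<in> F. card (e \<inter> Z s) = i} + (c + 2) * k + n \<le> card F + k + 2 * k\<^sup>2"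
    by blast
  show thesis
  proof (rule that)
    show "finite (Z s)" unfolding Z_def by simp
    show "1 \<le> i" using a i(1) by auto
    have "card (Z s) \<le> z" unfolding Z_def using card_image_le[of "{s * z..<s * z + z}" x] by simp
    also have "\<dots> < (a + 1) * (n div k)" by (rule z(3))
    also have "\<dots> \<le> (i + 1) * (n div k)" using i(1) by (intro mult_right_mono) auto
    finally show "card (Z s) < (i + 1) * (n div k)" .
    show "1 \<le> card {e \<in> F. i \<le> card (e \<inter> Z s)}" using pos[OF i(2)] by (simp add: h_def)
  qed (use i in \<open>simp_all add: h_def\<close>)
qed

text \<open>Consecutive edges exchange one vertex, so their intersection numbers with Z cannot jump
  over i. If all exceeded i, the n div k disjoint edges starting at multiples of k would each
  contain i + 1 points of Z, more than Z has.\<close>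

lemma path_stays_below_level:
  assumes x: "inj_on x {..<n}" "\<And>j. j + k \<le> n \<Longrightarrow> x ` {j..<j + k} \<in> F"
    and Z: "finite Z" "card Z < (i + 1) * (n div k)"
    and no: "\<And>e. e \<in> F \<Longrightarrow> card (e \<inter> Z) \<noteq> i"
  shows "j + k \<le> n \<Longrightarrow> card (x ` {j..<j + k} \<inter> Z) < i"
proof -
  define \<phi> where "\<phi> = (\<lambda>j. card (x ` {j..<j + k} \<inter> Z))"
  have step: "card (A \<inter> Z) \<le> card (B \<inter> Z) + 1" if "A \<subseteq> insert y B" for A B :: "'a set" and y
  proof -
    have "card (A \<inter> Z) \<le> card (insert y (B \<inter> Z))" using that Z(1) by (intro card_mono) auto
    also have "\<dots> \<le> card (B \<inter> Z) + 1" using Z(1) by (simp add: card_insert_if)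
    finally show ?thesis .
  qed
  have up: "\<phi> (Suc j) \<le> \<phi> j + 1" for j
    unfolding \<phi>_def by (rule step[of _ "x (j + k)"]) (auto simp: less_Suc_eq)
  have down: "\<phi> j \<le> \<phi> (Suc j) + 1" for j
  proof -
    have "{j..<j + k} \<subseteq> insert j {Suc j..<Suc j + k}" by auto
    then show ?thesis unfolding \<phi>_def by (intro step[of _ "x j"]) blast
  qed
  have ne: "\<phi> j \<noteq> i" if "j + k \<le> n" for j
    unfolding \<phi>_def using no x(2)[OF that] by blast
  have same: "\<phi> j < i \<longleftrightarrow> \<phi> 0 < i" if "j + k \<le> n" for j
    using that
  proof (induction j)
    case (Suc j)
    then show ?case using up[of j] down[of j] ne[of j] ne[of "Suc j"] by auto
  qed simp
  have "\<phi> 0 < i" if "k \<le> n"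
  proof (rule ccontr)
    assume "\<not> \<phi> 0 < i"
    then have big: "i + 1 \<le> \<phi> j" if "j + k \<le> n" for j
      using same[OF that] ne[OF that] by simp
    define p where "p = n div k"
    have pk: "t * k + k \<le> n" if "t < p" for t
    proof -
      have "(t + 1) * k \<le> n div k * k" using that unfolding p_def by (intro mult_right_mono) auto
      also have "\<dots> \<le> n" by simp
      finally show ?thesis by simp
    qed
    have disj: "x ` {s * k..<s * k + k} \<inter> x ` {t * k..<t * k + k} = {}" if "s < t" "t < p" for s t
    proof -
      have "(s + 1) * k \<le> t * k" using that by (intro mult_right_mono) auto
      then have "{s * k..<s * k + k} \<inter> {t * k..<t * k + k} = {}" by auto
      moreover have "{s * k..<s * k + k} \<subseteq> {..<n}" "{t * k..<t * k + k} \<subseteq> {..<n}"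
        using pk[of s] pk[of t] that by auto
      ultimately show ?thesis using inj_on_image_Int[OF x(1)] by (metis image_empty)
    qed
    have disj': "x ` {s * k..<s * k + k} \<inter> x ` {t * k..<t * k + k} = {}" if "s < p" "t < p" "s \<noteq> t" for s t
      using disj[of s t] disj[of t s] that by (cases "s < t") (auto simp: Int_commute)
    have "(i + 1) * p = (\<Sum>t<p. i + 1)" by simp
    also have "\<dots> \<le> (\<Sum>t<p. \<phi> (t * k))" using big pk by (intro sum_mono) simp
    also have "\<dots> = card (\<Union>t<p. x ` {t * k..<t * k + k} \<inter> Z)"
      unfolding \<phi>_def using Z(1) disj' by (intro card_UN_disjoint[symmetric]) blast+
    also have "\<dots> \<le> card Z" using Z(1) by (intro card_mono) auto
    finally show False using Z(2) unfolding p_def by simp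
  qed
  then show "j + k \<le> n \<Longrightarrow> card (x ` {j..<j + k} \<inter> Z) < i"
    using same[of j] unfolding \<phi>_def by simp
qed

text \<open>Induction on |F|, continuing with the edges below the cut level. The alternative H = {}
  is separate because the inequality can fail for small F.\<close>

lemma sparse_hitting_set:
  fixes F :: "'a set set" and k c n :: nat
  assumes k4: "4 \<le> k" and c: "1 \<le> c" "2 ^ (c + 1) \<le> k" "k < 2 ^ (c + 2)"
    and n: "k * k + k \<le> 2 * n"
    and F: "finite F" "\<And>e. e \<in> F \<Longrightarrow> finite e \<and> card e = k"
    and f: "card F + 2 * k\<^sup>2 + 1 \<le> (c + 2) * n"
  shows "\<exists>H\<subseteq>F. \<not> contains_path k n (F - H) \<and>
    (H = {} \<or> (c + 1) * card H + (c + 2) * k + n \<le> card F + k + 2 * k\<^sup>2)"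
  using F f
proof (induction "card F" arbitrary: F rule: less_induct)
  case less
  show ?case
  proof (cases "contains_path k n F")
    case False
    then show ?thesis by auto
  next
    case True
    obtain Z i where Z: "finite Z" "1 \<le> i" "card Z < (i + 1) * (n div k)"
      and h1: "1 \<le> card {e \<in> F. i \<le> card (e \<inter> Z)}"
      and L: "(c + 1) * card {e \<in> F. card (e \<inter> Z) = i} \<le> card {e \<in> F. i \<le> card (e \<inter> Z)}"
      "(c + 1) * card {e \<in> F. card (e \<inter> Z) = i} + (c + 2) * k + n \<le> card F + k + 2 * k\<^sup>2"
      by (rule good_cut[OF k4 c n less.prems(1,2) True less.prems(3)])
    define F' where "F' = {e \<in> F. card (e \<inter> Z) < i}"
    define C where "C = {e \<in> F. card (e \<inter> Z) = i}"
    have "F = F' \<union> {e \<in> F. i \<le> card (e \<inter> Z)}" unfolding F'_def by auto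
    then have card_F: "card F = card F' + card {e \<in> F. i \<le> card (e \<inter> Z)}"
      using less.prems(1) by (subst card_Un_disjoint[symmetric]) (auto simp: F'_def)
    have "\<exists>H\<subseteq>F'. \<not> contains_path k n (F' - H) \<and>
        (H = {} \<or> (c + 1) * card H + (c + 2) * k + n \<le> card F' + k + 2 * k\<^sup>2)"
      using less.prems card_F h1 by (intro less.hyps) (auto simp: F'_def)
    then obtain H' where H': "H' \<subseteq> F'" "\<not> contains_path k n (F' - H')"
      "H' = {} \<or> (c + 1) * card H' + (c + 2) * k + n \<le> card F' + k + 2 * k\<^sup>2" by blast
    have "\<not> contains_path k n (F - (H' \<union> C))"
    proof
      assume "contains_path k n (F - (H' \<union> C))"
      then obtain x where x: "inj_on x {..<n}" "\<And>j. j + k \<le> n \<Longrightarrow> x ` {j..<j + k} \<in> F - (H' \<union> C)"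
        unfolding contains_path_def by blast
      have "card (x ` {j..<j + k} \<inter> Z) < i" if "j + k \<le> n" for j
        using that Z by (intro path_stays_below_level[OF x]) (auto simp: C_def)
      then have "contains_path k n (F' - H')"
        unfolding contains_path_def F'_def using x by blast
      then show False using H'(2) by simp
    qed
    \<comment> \<open>For nonempty H' the cost of C is paid by |F| - |F'| and added to the inductive
      bound; for H' = {} the bound is started by the second inequality in \<open>L\<close>. This is
      why a cheap level must satisfy both.\<close>
    moreover have "(c + 1) * card (H' \<union> C) + (c + 2) * k + n \<le> card F + k + 2 * k\<^sup>2"
    proof -
      have "(c + 1) * card (H' \<union> C) \<le> (c + 1) * card H' + (c + 1) * card C"
        using mult_le_mono2[OF card_Un_le[of H' C], of "c + 1"] by (simp add: algebra_simps)
      then show ?thesis using H'(3) L card_F unfolding C_def[symmetric] by auto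
    qed
    moreover have "H' \<union> C \<subseteq> F" using H'(1) by (auto simp: F'_def C_def)
    ultimately show ?thesis by blast
  qed
qed

section \<open>Monochromatic tight paths\<close>

text \<open>By Ramsey's theorem a large complete k-graph has a monochromatic complete k-graph on n
  vertices, which contains the path. Hence the \<open>LEAST\<close> in \<open>size_ramsey\<close> is
  attained.\<close>

lemma exists_arrows_tight_path: "\<exists>G :: nat hypergraph. kgraph k G \<and> arrows G (tight_path k n)"
proof -
  obtain N :: nat where N: "partn_lst {..<N} [n, n] k" using ramsey_full by blast
  define G :: "nat hypergraph" where "G = \<lparr>verts = {..<N}, edges = nsets {..<N} k\<rparr>"
  have "arrows G (tight_path k n)"
    unfolding arrows_def
  proof
    fix c :: "nat set \<Rightarrow> colour"
    define c' where "c' = (\<lambda>e. if c e = Red then 0 else 1 :: nat)"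
    have "c' \<in> nsets {..<N} k \<rightarrow> {..<2}" by (auto simp: c'_def)
    then obtain i H where i: "i < length [n, n]" and H: "H \<in> nsets {..<N} ([n, n] ! i)" "c' ` nsets H k \<subseteq> {i}"
      by (rule partn_lstE[OF N]) auto
    have Hn: "H \<subseteq> {..<N}" "finite H" "card H = n"
      using H(1) i by (auto simp: nsets_def less_Suc_eq)
    then obtain f where f: "bij_betw f {1..n} H"
      using finite_same_card_bij[of "{1..n}" H] by auto
    define P where "P = \<lparr>verts = H, edges = (\<lambda>e. f ` e) ` edges (tight_path k n)\<rparr>"
    have sub: "edges P \<subseteq> nsets H k"
    proof
      fix e assume "e \<in> edges P"
      then obtain j where j: "1 \<le> j" "j + k \<le> n + 1" "e = f ` {j..<j + k}"
        by (auto simp: P_def tight_path_def)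
      then have s: "{j..<j + k} \<subseteq> {1..n}" by auto
      have "card e = k" unfolding j(3)
        using card_image[OF inj_on_subset[OF bij_betw_imp_inj_on[OF f] s]] by simp
      moreover have "e \<subseteq> H" unfolding j(3) using s bij_betw_imp_surj_on[OF f] by blast
      ultimately show "e \<in> nsets H k" using j(3) by (simp add: nsets_def)
    qed
    have "nsets H k \<subseteq> nsets {..<N} k" "nsets H k \<subseteq> Pow H"
      using Hn(1) by (auto simp: nsets_def)
    then have "subhypergraph P G"
      unfolding subhypergraph_def using sub Hn(1) by (simp add: G_def P_def) (meson subset_trans)
    moreover have "isomorphic (tight_path k n) P"
      unfolding isomorphic_def using f by (auto simp: P_def tight_path_def)
    moreover have "\<exists>col. \<forall>e\<in>edges P. c e = col"
    proof (cases "i = 0")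
      case True
      then have "\<forall>e\<in>edges P. c e = Red" using sub H(2) by (force simp: c'_def split: if_splits)
      then show ?thesis by blast
    next
      case False
      have "c e = Blue" if "e \<in> edges P" for e
      proof -
        have "c' e = i" using that sub H(2) by blast
        then show ?thesis using False by (cases "c e") (auto simp: c'_def)
      qed
      then show ?thesis by blast
    qed
    ultimately show "\<exists>H'. subhypergraph H' G \<and> isomorphic (tight_path k n) H' \<and> (\<exists>col. \<forall>e\<in>edges H'. c e = col)"
      by blast
  qed
  moreover have "kgraph k G" by (simp add: kgraph_def G_def)
  ultimately show ?thesis by blast
qed

lemma arrows_tight_path_contains_path:
  fixes G :: "'a hypergraph" and c :: "'a set \<Rightarrow> colour"
  assumes "arrows G (tight_path k n)"
  obtains col where "contains_path k n {e \<in> edges G. c e = col}"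
proof -
  from assms have "\<exists>H'. subhypergraph H' G \<and> isomorphic (tight_path k n) H' \<and> (\<exists>col. \<forall>e\<in>edges H'. c e = col)"
    unfolding arrows_def by (rule spec)
  then obtain H' col where H': "subhypergraph H' G" "isomorphic (tight_path k n) H'"
    "\<forall>e\<in>edges H'. c e = col"
    by blast
  then obtain f where f: "bij_betw f {1..n} (verts H')" "edges H' = (\<lambda>e. f ` e) ` edges (tight_path k n)"
    unfolding isomorphic_def by (auto simp: tight_path_def)
  \<comment> \<open>Composition with \<open>Suc\<close> translates the indices 0, ..., n - 1 to the
    vertices 1, ..., n of \<open>tight_path\<close>.\<close>
  have "inj_on (f \<circ> Suc) {..<n}"
    by (rule comp_inj_on) (auto intro: inj_on_subset[OF bij_betw_imp_inj_on[OF f(1)]])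
  moreover have "(f \<circ> Suc) ` {j..<j + k} \<in> {e \<in> edges G. c e = col}" if "j + k \<le> n" for j
  proof -
    have "{Suc j..<Suc j + k} \<in> edges (tight_path k n)" using that by (auto simp: tight_path_def intro!: exI[of _ "Suc j"])
    then have "f ` {Suc j..<Suc j + k} \<in> edges H'" unfolding f(2) by blast
    moreover have "(f \<circ> Suc) ` {j..<j + k} = f ` {Suc j..<Suc j + k}"
      by (simp only: image_comp[symmetric] image_Suc_atLeastLessThan add_Suc)
    ultimately show ?thesis using H' unfolding subhypergraph_def by auto
  qed
  ultimately show thesis using that unfolding contains_path_def by blast
qed

lemma card_edges_ge_of_arrows_tight_path:
  fixes G :: "'a hypergraph" and k c n :: nat
  assumes k4: "4 \<le> k" and c: "1 \<le> c" "2 ^ (c + 1) \<le> k" "k < 2 ^ (c + 2)"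
    and n: "k * k + k \<le> 2 * n"
    and G: "kgraph k G" "arrows G (tight_path k n)"
  shows "(c + 2) * n \<le> card (edges G) + 2 * k\<^sup>2"
proof (rule ccontr)
  assume "\<not> ?thesis"
  then have f: "card (edges G) + 2 * k\<^sup>2 + 1 \<le> (c + 2) * n" by simp
  have E: "finite (edges G)" "\<And>e. e \<in> edges G \<Longrightarrow> finite e \<and> card e = k"
    using G(1) finite_subset[OF _ finite_imp_finite_nsets] unfolding kgraph_def nsets_def by blast+
  have kn: "k \<le> n" using n k4 mult_le_mono1[of 4 k k] by linarith
  obtain H where H: "H \<subseteq> edges G" "\<not> contains_path k n (edges G - H)"
    "H = {} \<or> (c + 1) * card H + (c + 2) * k + n \<le> card (edges G) + k + 2 * k\<^sup>2"
    using sparse_hitting_set[OF k4 c n E f] by blast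
  obtain col where col: "contains_path k n {e \<in> edges G. (if e \<in> H then Red else Blue) = col}"
    by (rule arrows_tight_path_contains_path[OF G(2)])
  show False
  proof (cases col)
    case Blue
    then have "{e \<in> edges G. (if e \<in> H then Red else Blue) = col} = edges G - H" by auto
    then show False using col H(2) by simp
  next
    case Red
    then have "{e \<in> edges G. (if e \<in> H then Red else Blue) = col} = H" using H(1) by auto
    then have "n + 1 \<le> card H + k"
      using col card_ge_of_contains_path[of k n H] finite_subset[OF H(1) E(1)] k4 kn by simp
    \<comment> \<open>Inserted into the bound on H, this gives |F| + 2 k^2 >= (c + 2) n + c + 1 for
      the edge set F of G, contrary to \<open>f\<close>.\<close>
    then have "H \<noteq> {}" "(c + 1) * (n + 1) \<le> (c + 1) * (card H + k)"
      using kn by (auto intro: mult_le_mono2 simp del: mult_Suc mult_Suc_right)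
    then show False using H(3) f by (auto simp: algebra_simps)
  qed
qed

theorem theorem3:
  fixes k n :: nat
  assumes "k \<ge> 4"
    and "real n > ((real k)\<^sup>2 + real k - 2) / 2"
  shows "real (size_ramsey k (tight_path k n))
           \<ge> real_of_int \<lceil>log 2 (real k + 1)\<rceil> * real n - 2 * (real k)\<^sup>2"
proof -
  have "real (k * k + k) < real (2 * n + 2)"
    using assms(2) by (simp add: power2_eq_square field_simps)
  then have "k * k + k < 2 * n + 2" unfolding of_nat_less_iff .
  \<comment> \<open>As k^2 + k is even, the strict bound by 2 n + 2 sharpens to k^2 + k <= 2
    n.\<close>
  moreover obtain q where q: "k * k + k = 2 * q"
    using evenE[of "k * k + k"] by auto
  ultimately have "q \<le> n" by linarith
  then have n: "k * k + k \<le> 2 * n" using q by linarith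
  obtain m where m: "2 ^ m \<le> k" "k < 2 ^ (m + 1)"
    using ex_power_ivl1[of 2 k] assms(1) by auto
  have "2 \<le> m"
  proof (rule ccontr)
    assume "\<not> 2 \<le> m"
    then have "2 ^ (m + 1) \<le> (2::nat) ^ 2" by (intro power_increasing) auto
    then show False using m assms(1) by simp
  qed
  then obtain c where c: "1 \<le> c" "m = c + 1" by (cases m) auto
  \<comment> \<open>The choice of m gives 2^m < k + 1 <= 2^(m + 1), so the ceiling is m + 1.\<close>
  have r: "\<lceil>log 2 (real k + 1)\<rceil> = int (c + 2)"
    using ceiling_log_nat_eq_if[of 2 m "k + 1"] m c(2) by (simp add: add.commute)
  obtain G :: "nat hypergraph" where G: "kgraph k G" "arrows G (tight_path k n)"
    "card (edges G) = size_ramsey k (tight_path k n)"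
  proof -
    have "\<exists>m. \<exists>G :: nat hypergraph. kgraph k G \<and> card (edges G) = m \<and> arrows G (tight_path k n)"
      using exists_arrows_tight_path by blast
    from LeastI_ex[OF this] show thesis
      using that unfolding size_ramsey_def by blast
  qed
  have "(c + 2) * n \<le> size_ramsey k (tight_path k n) + 2 * k\<^sup>2"
    using card_edges_ge_of_arrows_tight_path[of k c n G] assms(1) c m n G by simp
  then have "real ((c + 2) * n) \<le> real (size_ramsey k (tight_path k n) + 2 * k\<^sup>2)"
    unfolding of_nat_le_iff .
  then show ?thesis unfolding r by (simp add: algebra_simps)
qed

end
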